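(* Let $\boldsymbol{\alpha},\boldsymbol{\alpha}',\boldsymbol{\beta},\boldsymbol{\beta}'$ be $n$-dimensional complex measures (on possibly different measurable spaces). If $\mathsf{LH}(\boldsymbol{\alpha})\subseteq\mathsf{LH}(\boldsymbol{\alpha}')$ and $\mathsf{LH}(\boldsymbol{\beta})\subseteq\mathsf{LH}(\boldsymbol{\beta}')$, then $\mathsf{LH}(\boldsymbol{\alpha}\times\boldsymbol{\beta})\subseteq\mathsf{LH}(\boldsymbol{\alpha}'\times\boldsymbol{\beta}')$.
   Context: A complex measure on a measurable space $(S,\mathcal{F})$ is a countably additive function $\alpha:\mathcal{F}\to\mathbb{C}$. An $n$-dimensional complex measure on $(S,\mathcal{F})$ is a function $\boldsymbol{\alpha}=(\alpha_1,\dots,\alpha_n):\mathcal{F}\to\mathbb{C}^n$ each of whose components is a complex measure on $(S,\mathcal{F})$. Its Lorenz hull $\mathsf{LH}(\boldsymbol{\alpha})\subseteq\mathbb{C}^n$ is the convex hull (convex combinations with real nonnegative coefficients summing to $1$) of its range $\{\boldsymbol{\alpha}(A):A\in\mathcal{F}\}$. For $\boldsymbol{\alpha}=(\alpha_1,\dots,\alpha_n)$ on $(S,\mathcal{F})$ and $\boldsymbol{\beta}=(\beta_1,\dots,\beta_n)$ on $(T,\mathcal{G})$, $\boldsymbol{\alpha}\times\boldsymbol{\beta}:=(\alpha_1\times\beta_1,\dots,\alpha_n\times\beta_n)$, where $\alpha_i\times\beta_i$ is the unique complex measure on the product measurable space $(S,\mathcal{F})\times(T,\mathcal{G})$ with $(\alpha_i\times\beta_i)(A\times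 B)=\alpha_i(A)\beta_i(B)$ for all $A\in\mathcal{F}$, $B\in\mathcal{G}$. *)

theory Defs
  imports "HOL-Analysis.Analysis"
begin

(* A measure object M serves only as a measurable space (space M, sets M);
   its emeasure is never used.  Values of set functions outside sets M are irrelevant. *)

(* Taking all A i empty forces \<alpha> {} = 0.  The condition applies to every reordering
   of a disjoint family, so the convergence is automatically absolute. *)
definition complex_measure :: "'a measure \<Rightarrow> ('a set \<Rightarrow> complex) \<Rightarrow> bool" where
  "complex_measure M \<alpha> \<longleftrightarrow>
     (\<forall>A :: nat \<Rightarrow> 'a set. range A \<subseteq> sets M \<longrightarrow> disjoint_family A \<longrightarrow>
        (\<lambda>i. \<alpha> (A i)) sums \<alpha> (\<Union>i. A i))"

definition vector_complex_measure ::
    "'a measure \<Rightarrow> ('a set \<Rightarrow> complex ^ 'n) \<Rightarrow> bool" where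
  "vector_complex_measure M \<alpha> \<longleftrightarrow> (\<forall>i. complex_measure M (\<lambda>A. \<alpha> A $ i))"

definition lorenz_hull :: "'a measure \<Rightarrow> ('a set \<Rightarrow> complex ^ 'n) \<Rightarrow> (complex ^ 'n) set" where
  "lorenz_hull M \<alpha> = convex hull (\<alpha> ` sets M)"

(* A product measure is determined only on sets (M \<Otimes>\<^sub>M N); extensionality fixes the
   remaining values of the total function, so that the description is unique. *)
definition complex_prod_measure ::
    "'a measure \<Rightarrow> ('a set \<Rightarrow> complex) \<Rightarrow> 'b measure \<Rightarrow> ('b set \<Rightarrow> complex) \<Rightarrow>
     ('a \<times> 'b) set \<Rightarrow> complex" where
  "complex_prod_measure M \<alpha> N \<beta> =
     (THE \<gamma>. \<gamma> \<in> extensional (sets (M \<Otimes>\<^sub>M N)) \<and> complex_measure (M \<Otimes>\<^sub>M N) \<gamma> \<and>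
        (\<forall>A\<in>sets M. \<forall>B\<in>sets N. \<gamma> (A \<times> B) = \<alpha> A * \<beta> B))"

definition vector_prod_measure ::
    "'a measure \<Rightarrow> ('a set \<Rightarrow> complex ^ 'n) \<Rightarrow> 'b measure \<Rightarrow> ('b set \<Rightarrow> complex ^ 'n) \<Rightarrow>
     ('a \<times> 'b) set \<Rightarrow> complex ^ 'n" where
  "vector_prod_measure M \<alpha> N \<beta> C =
     (\<chi> i. complex_prod_measure M (\<lambda>A. \<alpha> A $ i) N (\<lambda>B. \<beta> B $ i) C)"

end

theory Submission
  imports Defs
begin

text \<open>
  The Lorenz hull is a convex set, so it is compared with another one through support functions.
  Write the two vector measures as densities \<open>a\<close> and \<open>b\<close> with respect to finite positive measures
  \<open>L\<close> and \<open>K\<close> (\<open>sigma_additive_density\<close>). The largest value of the linear functional \<open>u \<bullet> _\<close> on the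
  Lorenz hull of \<open>a\<close> is the integral of the positive part of \<open>u \<bullet> a\<close>: one integrates \<open>a\<close> over the set
  where \<open>u \<bullet> a\<close> is positive. The product measure has the density \<open>a s * b t\<close>, and since the product
  is taken in every component, \<open>u \<bullet> (a s * b t) = (u * cnj_vec (b t)) \<bullet> a s\<close>. By Tonelli the support
  function of the product is therefore an integral over \<open>t\<close> of values of the support function of \<open>a\<close>,
  so it grows when the latter does (\<open>support_of_product_density\<close>, \<open>zonoid_product_mono\<close>). Replacing
  \<open>a\<close> first and then \<open>b\<close> gives the inequality between the support functions of the two products.
  
  An inequality of support functions only yields an inclusion of closures, so one also needs that
  a Lorenz hull is closed (\<open>closed_zonoid\<close>); this is where finite dimension enters. It is a version of
  Lyapunov's theorem that allows atoms because the convex hull is taken. The proof is by induction on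
  the dimension. A point of the closure that lies in the relative interior of the closure is already
  in the hull. Any other point minimises some functional \<open>u \<bullet> _\<close> over the closure. Sets for which
  \<open>u \<bullet> _\<close> is nearly minimal must nearly agree with \<open>{u \<bullet> a < 0}\<close> outside \<open>{u \<bullet> a = 0}\<close>, so up to a
  translation the point lies in the closure of the hull of \<open>a\<close> restricted to \<open>{u \<bullet> a = 0}\<close>, which has
  smaller dimension.
\<close>

section \<open>Sigma-additive vector-valued set functions\<close>

lemma ennreal_max_zero: "ennreal (max 0 r) = ennreal r"
  by (simp add: max_def ennreal_neg)

definition sigma_additive :: "'a measure \<Rightarrow> ('a set \<Rightarrow> 'b::real_normed_vector) \<Rightarrow> bool" where
  "sigma_additive M f \<longleftrightarrow>
     (\<forall>A :: nat \<Rightarrow> 'a set. range A \<subseteq> sets M \<longrightarrow> disjoint_family A \<longrightarrow>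
        (\<lambda>i. f (A i)) sums f (\<Union>i. A i))"

lemma sigma_additiveD:
  "sigma_additive M f \<Longrightarrow> range A \<subseteq> sets M \<Longrightarrow> disjoint_family A \<Longrightarrow>
    (\<lambda>i::nat. f (A i)) sums f (\<Union>i. A i)"
  by (simp add: sigma_additive_def)

lemma sigma_additive_empty:
  assumes "sigma_additive M f"
  shows "f {} = 0"
proof -
  have "(\<lambda>i::nat. f {}) sums f (\<Union>i::nat. {})"
    using assms by (intro sigma_additiveD[OF assms]) (auto simp: disjoint_family_on_def)
  then have "(\<lambda>i::nat. f {}) \<longlonglongrightarrow> 0"
    by (intro summable_LIMSEQ_zero sums_summable)
  then show ?thesis
    by (simp add: LIMSEQ_const_iff)
qed

lemma sigma_additive_Un:
  assumes f: "sigma_additive M f" and "A \<in> sets M" "B \<in> sets M" "A \<inter> B = {}"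
  shows "f (A \<union> B) = f A + f B"
proof -
  have "(\<lambda>n. f (binaryset A B n)) sums f (\<Union>i. binaryset A B i)"
    using assms by (intro sigma_additiveD[OF f])
      (auto simp: range_binaryset_eq disjoint_family_on_def binaryset_def)
  moreover have "(\<lambda>n. f (binaryset A B n)) sums (f A + f B)"
    by (intro binaryset_sums sigma_additive_empty[OF f])
  ultimately show ?thesis
    by (simp add: UN_binaryset_eq sums_unique2)
qed

lemma sigma_additive_Diff:
  assumes f: "sigma_additive M f" and "A \<in> sets M" "B \<in> sets M" "B \<subseteq> A"
  shows "f (A - B) = f A - f B"
proof -
  have "f (B \<union> (A - B)) = f B + f (A - B)"
    using assms by (intro sigma_additive_Un[OF f]) auto
  moreover have "B \<union> (A - B) = A" using assms by auto
  ultimately show ?thesis by simp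
qed

lemma sigma_additive_bounded_linear:
  "bounded_linear h \<Longrightarrow> sigma_additive M f \<Longrightarrow> sigma_additive M (\<lambda>A. h (f A))"
  unfolding sigma_additive_def by (intro allI impI bounded_linear.sums[of h]) simp_all

text \<open>
  If \<open>f\<close> is unbounded on the subsets of \<open>A\<close>, then \<open>A\<close> splits into two pieces with large values of \<open>f\<close>,
  and \<open>f\<close> is again unbounded on one of them. Iterating, the discarded pieces form a disjoint sequence
  with values of norm above 1, which contradicts the convergence of their series.
\<close>

lemma sigma_additive_bounded:
  assumes f: "sigma_additive M f"
  shows "bounded (f ` sets M)"
proof (rule ccontr)
  define U where "U A \<longleftrightarrow> A \<in> sets M \<and> \<not> bounded (f ` {B \<in> sets M. B \<subseteq> A})" for A
  assume "\<not> bounded (f ` sets M)"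
  moreover have "{B \<in> sets M. B \<subseteq> space M} = sets M"
    using sets.sets_into_space by auto
  ultimately have U0: "U (space M)"
    by (simp add: U_def)
  have step: "\<exists>A'. U A' \<and> (A' \<subseteq> A \<and> 1 < norm (f (A - A')))" if "U A" for A
  proof -
    have A: "A \<in> sets M" and unb: "\<not> bounded (f ` {B \<in> sets M. B \<subseteq> A})"
      using that by (auto simp: U_def)
    obtain B where B: "B \<in> sets M" "B \<subseteq> A" "1 + norm (f A) < norm (f B)"
      using unb unfolding bounded_iff by (auto simp: not_le) 
    have AB: "f (A - B) = f A - f B"
      by (intro sigma_additive_Diff[OF f]) (use A B in auto)
    have nAB: "1 < norm (f (A - B))"
      unfolding AB using B(3) norm_triangle_ineq2[of "f B" "f A"] by (simp add: norm_minus_commute)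
    have "U B \<or> U (A - B)"
    proof (rule ccontr)
      assume "\<not> (U B \<or> U (A - B))"
      then have "bounded (f ` {C \<in> sets M. C \<subseteq> B})" "bounded (f ` {C \<in> sets M. C \<subseteq> A - B})"
        using A B by (auto simp: U_def)
      then obtain K L where K: "\<forall>C\<in>{C \<in> sets M. C \<subseteq> B}. norm (f C) \<le> K"
        and L: "\<forall>C\<in>{C \<in> sets M. C \<subseteq> A - B}. norm (f C) \<le> L"
        unfolding bounded_iff by (simp only: ball_simps) blast
      have "norm (f C) \<le> K + L" if C: "C \<in> sets M" "C \<subseteq> A" for C
      proof -
        have "f ((C \<inter> B) \<union> (C - B)) = f (C \<inter> B) + f (C - B)"
          using B C by (intro sigma_additive_Un[OF f]) auto
        moreover have "(C \<inter> B) \<union> (C - B) = C" by auto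
        moreover have "norm (f (C \<inter> B)) \<le> K" "norm (f (C - B)) \<le> L"
          using B C by (auto intro!: K[rule_format] L[rule_format])
        ultimately show ?thesis
          using norm_triangle_ineq[of "f (C \<inter> B)" "f (C - B)"] by simp
      qed
      then show False
        using unb unfolding bounded_iff by auto
    qed
    then show ?thesis
    proof
      assume "U B"
      then show ?thesis using B nAB by blast
    next
      assume "U (A - B)"
      moreover have "A - (A - B) = B" using B by auto
      moreover have "1 < norm (f B)"
        using B(3) norm_ge_zero[of "f A"] by linarith
      ultimately show ?thesis by (intro exI[of _ "A - B"]) auto
    qed
  qed
  obtain A where A: "\<And>n::nat. U (A n)" "\<And>n. A (Suc n) \<subseteq> A n \<and> 1 < norm (f (A n - A (Suc n)))"
    using dependent_nat_choice[of "\<lambda>_. U" "\<lambda>_ A A'. A' \<subseteq> A \<and> 1 < norm (f (A - A'))"] U0 step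
    by metis
  have dec: "decseq A"
    using A(2) by (intro decseq_SucI) auto
  have "disjoint_family (\<lambda>n. A n - A (Suc n))"
  proof -
    have "(A m - A (Suc m)) \<inter> (A n - A (Suc n)) = {}" if "m < n" for m n
      using decseqD[OF dec, of "Suc m" n] that by auto
    then show ?thesis
      unfolding disjoint_family_on_def by (metis Int_commute linorder_neqE_nat)
  qed
  then have "(\<lambda>n. f (A n - A (Suc n))) sums f (\<Union>n. A n - A (Suc n))"
    using A(1) by (intro sigma_additiveD[OF f]) (auto simp: U_def)
  then have "(\<lambda>n. f (A n - A (Suc n))) \<longlonglongrightarrow> 0"
    by (intro summable_LIMSEQ_zero sums_summable)
  then have "eventually (\<lambda>n. norm (f (A n - A (Suc n))) < 1) sequentially"
    using order_tendstoD(2)[OF tendsto_norm_zero] by fastforce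
  then obtain n where "norm (f (A n - A (Suc n))) < 1"
    by (auto simp: eventually_sequentially)
  with A(2)[of n] show False by simp
qed

section \<open>Jordan decomposition and densities\<close>

text \<open>
  The positive part of the Jordan decomposition. Negative values of \<open>f\<close> are truncated to \<open>0\<close> by
  \<open>ennreal\<close>, which agrees with the value at the empty set, so the supremum is not affected.
\<close>

definition upper_variation :: "'a measure \<Rightarrow> ('a set \<Rightarrow> real) \<Rightarrow> 'a set \<Rightarrow> ennreal" where
  "upper_variation M f A = (SUP B\<in>{B \<in> sets M. B \<subseteq> A}. ennreal (f B))"

lemma upper_variation_upper:
  "B \<in> sets M \<Longrightarrow> B \<subseteq> A \<Longrightarrow> ennreal (f B) \<le> upper_variation M f A"
  unfolding upper_variation_def by (intro SUP_upper) auto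

lemma upper_variation_mono:
  "A \<subseteq> B \<Longrightarrow> upper_variation M f A \<le> upper_variation M f B"
  unfolding upper_variation_def by (intro SUP_subset_mono) auto

text \<open>
  Superadditivity is the lower half of countable additivity. When one of two values is negative, its
  set can be dropped.
\<close>

lemma upper_variation_Un:
  assumes f: "sigma_additive M f" and "A \<in> sets M" "B \<in> sets M" "A \<inter> B = {}"
  shows "upper_variation M f A + upper_variation M f B \<le> upper_variation M f (A \<union> B)"
proof -
  have *: "ennreal (f C) + ennreal (f D) \<le> upper_variation M f (A \<union> B)"
    if C: "C \<in> sets M" "C \<subseteq> A" and D: "D \<in> sets M" "D \<subseteq> B" for C D
  proof -
    consider "f C \<ge> 0" "f D \<ge> 0" | "f C \<le> 0" | "f D \<le> 0" by linarith
    then show ?thesis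
    proof cases
      case 1
      have "f (C \<union> D) = f C + f D"
        using assms C D by (intro sigma_additive_Un[OF f]) auto
      then have "ennreal (f C) + ennreal (f D) = ennreal (f (C \<union> D))"
        using 1 by simp
      also have "\<dots> \<le> upper_variation M f (A \<union> B)"
        using C D by (intro upper_variation_upper) auto
      finally show ?thesis .
    next
      case 2
      then have "ennreal (f C) + ennreal (f D) = ennreal (f D)"
        by (simp add: ennreal_neg)
      also have "\<dots> \<le> upper_variation M f (A \<union> B)"
        using D by (intro upper_variation_upper) auto
      finally show ?thesis .
    next
      case 3
      then have "ennreal (f C) + ennreal (f D) = ennreal (f C)"
        by (simp add: ennreal_neg)
      also have "\<dots> \<le> upper_variation M f (A \<union> B)"
        using C by (intro upper_variation_upper) auto
      finally show ?thesis .
    qed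
  qed
  have ne: "{C \<in> sets M. C \<subseteq> X} \<noteq> {}" for X by auto
  show ?thesis
    unfolding upper_variation_def[of M f A] upper_variation_def[of M f B]
    by (subst ennreal_SUP_add_left[OF ne, symmetric], rule SUP_least,
        subst ennreal_SUP_add_right[OF ne], rule SUP_least) (use * in auto)
qed

lemma countably_additive_upper_variation:
  assumes f: "sigma_additive M f"
  shows "countably_additive (sets M) (upper_variation M f)"
proof (rule countably_additiveI)
  fix A :: "nat \<Rightarrow> 'a set"
  assume A: "range A \<subseteq> sets M" "disjoint_family A" "(\<Union>i. A i) \<in> sets M"
  show "(\<Sum>i. upper_variation M f (A i)) = upper_variation M f (\<Union>i. A i)"
  proof (rule antisym)
    have fin: "(\<Sum>i<n. upper_variation M f (A i)) \<le> upper_variation M f (\<Union>i<n. A i)" for n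
    proof (induction n)
      case (Suc n)
      have "(\<Sum>i<Suc n. upper_variation M f (A i))
          \<le> upper_variation M f (\<Union>i<n. A i) + upper_variation M f (A n)"
        using Suc by (simp add: add_right_mono)
      also have "\<dots> \<le> upper_variation M f ((\<Union>i<n. A i) \<union> A n)"
        using A by (intro upper_variation_Un[OF f])
          (auto simp: disjoint_family_on_def, metis IntI empty_iff less_irrefl)
      also have "(\<Union>i<n. A i) \<union> A n = (\<Union>i<Suc n. A i)"
        by (auto simp: lessThan_Suc)
      finally show ?case .
    qed simp
    have "(\<Sum>i<n. upper_variation M f (A i)) \<le> upper_variation M f (\<Union>i. A i)" for n
      using fin[of n] by (rule order_trans) (auto intro!: upper_variation_mono)
    then show "(\<Sum>i. upper_variation M f (A i)) \<le> upper_variation M f (\<Union>i. A i)"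
      by (intro suminf_le_const) auto
  next
    show "upper_variation M f (\<Union>i. A i) \<le> (\<Sum>i. upper_variation M f (A i))"
      unfolding upper_variation_def[of M f "\<Union>i. A i"]
    proof (rule SUP_least)
      fix B assume "B \<in> {B \<in> sets M. B \<subseteq> (\<Union>i. A i)}"
      then have B: "B \<in> sets M" "(\<Union>i. B \<inter> A i) = B" by auto
      have "(\<lambda>i. f (B \<inter> A i)) sums f (\<Union>i. B \<inter> A i)"
        using A B(1) by (intro sigma_additiveD[OF f]) (auto simp: disjoint_family_on_def)
      then have "(\<lambda>n. ennreal (\<Sum>i<n. f (B \<inter> A i))) \<longlonglongrightarrow> ennreal (f B)"
        unfolding B(2) by (intro tendsto_ennrealI) (simp add: sums_def)
      moreover have "ennreal (\<Sum>i<n. f (B \<inter> A i)) \<le> (\<Sum>i. upper_variation M f (A i))" for n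
      proof -
        have "ennreal (\<Sum>i<n. f (B \<inter> A i)) \<le> ennreal (\<Sum>i<n. max 0 (f (B \<inter> A i)))"
          by (intro ennreal_leI sum_mono) auto
        also have "\<dots> = (\<Sum>i<n. ennreal (f (B \<inter> A i)))"
          using sum_ennreal[of "{..<n}" "\<lambda>i. max 0 (f (B \<inter> A i))"]
          by (simp only: ennreal_max_zero max.cobounded1)
        also have "\<dots> \<le> (\<Sum>i<n. upper_variation M f (A i))"
          using A B(1) by (intro sum_mono upper_variation_upper) auto
        also have "\<dots> \<le> (\<Sum>i. upper_variation M f (A i))"
          by (intro sum_le_suminf) auto
        finally show ?thesis .
      qed
      ultimately show "ennreal (f B) \<le> (\<Sum>i. upper_variation M f (A i))"
        by (intro LIMSEQ_le_const2) auto
    qed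
  qed
qed

lemma upper_variation_finite:
  assumes f: "sigma_additive M f"
  shows "upper_variation M f A < \<infinity>"
proof -
  obtain K where K: "\<And>B. B \<in> sets M \<Longrightarrow> norm (f B) \<le> K"
    using sigma_additive_bounded[OF f] unfolding bounded_iff by auto
  have "upper_variation M f A \<le> ennreal K"
    unfolding upper_variation_def
  proof (rule SUP_least)
    fix B assume "B \<in> {B \<in> sets M. B \<subseteq> A}"
    then show "ennreal (f B) \<le> ennreal K"
      using K[of B] by (intro ennreal_leI) auto
  qed
  then show ?thesis
    by (simp add: le_less_trans)
qed

lemma upper_variation_empty:
  "sigma_additive M f \<Longrightarrow> upper_variation M f {} = 0"
  by (auto simp: upper_variation_def sigma_additive_empty)

text \<open>
  Passing from \<open>B\<close> to \<open>A - B\<close> turns the supremum of \<open>f\<close> over the subsets of \<open>A\<close> into \<open>f A\<close> plus the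
  supremum of \<open>- f\<close>. One inequality suffices, since the other is the same statement for \<open>- f\<close>.
\<close>

lemma jordan_decomposition:
  assumes f: "sigma_additive M f" and A: "A \<in> sets M"
  shows "f A = enn2real (upper_variation M f A) - enn2real (upper_variation M (\<lambda>B. - f B) A)"
proof -
  have le: "enn2real (upper_variation M g A) \<le> enn2real (upper_variation M (\<lambda>B. - g B) A) + g A"
    if g: "sigma_additive M g" for g :: "'a set \<Rightarrow> real"
  proof -
    let ?n = "enn2real (upper_variation M (\<lambda>B. - g B) A)"
    have g': "sigma_additive M (\<lambda>B. - g B)"
      by (rule sigma_additive_bounded_linear[OF bounded_linear_minus[OF bounded_linear_ident] g])
    have neg: "- g B \<le> ?n" if "B \<in> sets M" "B \<subseteq> A" for B
    proof -
      have "ennreal (- g B) \<le> ennreal ?n"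
        using upper_variation_upper[OF that, of "\<lambda>B. - g B"] upper_variation_finite[OF g', of A]
        by simp
      then show ?thesis
        using enn2real_nonneg[of "upper_variation M (\<lambda>B. - g B) A"]
        by (auto simp: ennreal_le_iff2)
    qed
    have "upper_variation M g A \<le> ennreal (?n + g A)"
      unfolding upper_variation_def[of M g A]
    proof (rule SUP_least)
      fix B assume "B \<in> {B \<in> sets M. B \<subseteq> A}"
      then have B: "B \<in> sets M" "B \<subseteq> A" by auto
      have "g (A - B) = g A - g B"
        by (rule sigma_additive_Diff[OF g A B])
      with neg[of "A - B"] A B show "ennreal (g B) \<le> ennreal (?n + g A)"
        by (intro ennreal_leI) auto
    qed
    moreover have "0 \<le> ?n + g A"
      using neg[of A] A by auto
    ultimately show ?thesis
      by (metis enn2real_leI)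
  qed
  have f': "sigma_additive M (\<lambda>B. - f B)"
    by (rule sigma_additive_bounded_linear[OF bounded_linear_minus[OF bounded_linear_ident] f])
  show ?thesis
    using le[OF f] le[OF f'] by simp
qed

lemma emeasure_measure_of_countably_additive:
  assumes "countably_additive (sets M) \<mu>" "\<mu> {} = 0" "A \<in> sets M"
  shows "emeasure (measure_of (space M) (sets M) \<mu>) A = \<mu> A"
  using assms sets.sigma_algebra_axioms[of M]
  by (intro emeasure_measure_of_sigma) (auto simp: positive_def)

text \<open>
  The sum of the positive and negative variations of all coordinates is a finite measure that
  dominates each of them, so the Radon-Nikodym theorem provides densities of the coordinates with
  respect to one common measure.
\<close>

lemma sigma_additive_density:
  fixes f :: "'a set \<Rightarrow> 'e::euclidean_space"
  assumes f: "sigma_additive M f"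
  obtains L a where "finite_measure L" "sets L = sets M" "integrable L a"
    "\<And>A. A \<in> sets M \<Longrightarrow> f A = set_lebesgue_integral L A a"
proof -
  \<comment> \<open>The negative variation in direction \<open>b\<close> is the upper variation in direction \<open>- b\<close>.\<close>
  define D :: "'e set" where "D = Basis \<union> uminus ` Basis"
  have finD: "finite D" by (simp add: D_def)
  define v where "v u = upper_variation M (\<lambda>A. f A \<bullet> u)" for u
  have fu: "sigma_additive M (\<lambda>A. f A \<bullet> u)" for u
    by (rule sigma_additive_bounded_linear[OF bounded_linear_inner_left f])
  have ca: "countably_additive (sets M) (v u)" for u
    unfolding v_def by (rule countably_additive_upper_variation[OF fu])
  have v0: "v u {} = 0" for u
    unfolding v_def by (rule upper_variation_empty[OF fu])
  have vfin: "v u A < \<infinity>" for u A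
    unfolding v_def by (rule upper_variation_finite[OF fu])
  define L where "L = measure_of (space M) (sets M) (\<lambda>A. \<Sum>u\<in>D. v u A)"
  have setsL[simp]: "sets L = sets M" and spaceL: "space L = space M"
    by (auto simp: L_def sets.sets_measure_of_eq sets.space_measure_of_eq)
  have emL: "emeasure L A = (\<Sum>u\<in>D. v u A)" if "A \<in> sets M" for A
    unfolding L_def
  proof (rule emeasure_measure_of_countably_additive)
    show "countably_additive (sets M) (\<lambda>A. \<Sum>u\<in>D. v u A)"
    proof (rule countably_additiveI)
      fix A :: "nat \<Rightarrow> 'a set"
      assume A: "range A \<subseteq> sets M" "disjoint_family A" "(\<Union>i. A i) \<in> sets M"
      have "(\<Sum>i. \<Sum>u\<in>D. v u (A i)) = (\<Sum>u\<in>D. \<Sum>i. v u (A i))"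
        by (rule suminf_sum) auto
      also have "\<dots> = (\<Sum>u\<in>D. v u (\<Union>i. A i))"
        using ca A by (intro sum.cong) (auto simp: countably_additive_def)
      finally show "(\<Sum>i. \<Sum>u\<in>D. v u (A i)) = (\<Sum>u\<in>D. v u (\<Union>i. A i))" .
    qed
  qed (use that v0 in auto)
  have finL: "finite_measure L"
    by (rule finite_measureI) (use finD vfin in \<open>auto simp: emL spaceL less_top[symmetric]\<close>)
  interpret L: finite_measure L by fact
  have "\<exists>g. integrable L g \<and> (\<forall>A\<in>sets M. enn2real (v u A) = set_lebesgue_integral L A g)"
    if u: "u \<in> D" for u
  proof -
    define V where "V = measure_of (space M) (sets M) (v u)"
    have setsV[simp]: "sets V = sets M" and spaceV: "space V = space M"
      by (auto simp: V_def sets.sets_measure_of_eq sets.space_measure_of_eq)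
    have emV: "emeasure V A = v u A" if "A \<in> sets M" for A
      unfolding V_def by (rule emeasure_measure_of_countably_additive[OF ca v0 that])
    interpret V: finite_measure V
      by (rule finite_measureI) (use vfin in \<open>auto simp: emV spaceV less_top[symmetric]\<close>)
    have le: "v u A \<le> emeasure L A" if "A \<in> sets M" for A
      using that u finD by (auto simp: emL intro!: member_le_sum)
    have ac: "absolutely_continuous L V"
      unfolding absolutely_continuous_def null_sets_def
      using le emV by (auto simp: ) (metis le le_zero_eq)
    obtain d where d[measurable]: "d \<in> borel_measurable L" and nn: "\<And>x. 0 \<le> (d x :: real)"
      and rn: "AE x in L. RN_deriv L V x = ennreal (d x)"
      using L.real_RN_deriv[OF V.finite_measure_axioms ac] by (auto simp: )
    have nnA: "(\<integral>\<^sup>+x. ennreal (indicator A x *\<^sub>R d x) \<partial>L) = v u A" if A[measurable]: "A \<in> sets M" for A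
    proof -
      have "v u A = emeasure (density L (RN_deriv L V)) A"
        using A by (subst L.density_RN_deriv[OF ac]) (auto simp: emV)
      also have "\<dots> = (\<integral>\<^sup>+x. RN_deriv L V x * indicator A x \<partial>L)"
        using A by (intro emeasure_density) auto
      also have "\<dots> = (\<integral>\<^sup>+x. ennreal (indicator A x *\<^sub>R d x) \<partial>L)"
        by (rule nn_integral_cong_AE) (use rn in eventually_elim, auto split: split_indicator)
      finally show ?thesis by simp
    qed
    have int: "integrable L d"
    proof (rule integrableI_bounded)
      have "(\<integral>\<^sup>+x. ennreal (norm (d x)) \<partial>L) = (\<integral>\<^sup>+x. ennreal (indicator (space M) x *\<^sub>R d x) \<partial>L)"
        using nn by (intro nn_integral_cong) (auto simp: spaceL)
      also have "\<dots> < \<infinity>"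
        using nnA[of "space M"] vfin by simp
      finally show "(\<integral>\<^sup>+x. ennreal (norm (d x)) \<partial>L) < \<infinity>" .
    qed simp
    have "enn2real (v u A) = set_lebesgue_integral L A d" if A: "A \<in> sets M" for A
    proof -
      have [measurable]: "A \<in> sets L" using A by simp
      show ?thesis
        unfolding set_lebesgue_integral_def nnA[OF A, symmetric]
        using nn by (intro integral_eq_nn_integral[symmetric]) simp_all
    qed
    with int show ?thesis by blast
  qed
  then obtain g where g: "\<And>u. u \<in> D \<Longrightarrow> integrable L (g u)"
    "\<And>u A. u \<in> D \<Longrightarrow> A \<in> sets M \<Longrightarrow> enn2real (v u A) = set_lebesgue_integral L A (g u)"
    by metis
  define a where "a x = (\<Sum>b\<in>Basis. (g b x - g (- b) x) *\<^sub>R b)" for x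
  have D: "b \<in> D" "- b \<in> D" if "b \<in> Basis" for b
    using that by (auto simp: D_def)
  have inta: "integrable L a"
    unfolding a_def using g(1) D by (intro Bochner_Integration.integrable_sum integrable_scaleR_left) auto
  have "f A = set_lebesgue_integral L A a" if A: "A \<in> sets M" for A
  proof (rule euclidean_eqI)
    fix b :: 'e assume b: "b \<in> Basis"
    have sint: "set_integrable L A (g u)" if "u \<in> D" for u
      unfolding set_integrable_def using g(1)[OF that] A by (intro integrable_mult_indicator) auto
    have ab: "a x \<bullet> b = g b x - g (- b) x" for x
      using b by (simp add: a_def inner_sum_left inner_Basis if_distrib cong: if_cong)
    have "f A \<bullet> b = enn2real (v b A) - enn2real (v (- b) A)"
      using jordan_decomposition[OF fu A, of b] by (simp add: v_def)
    also have "\<dots> = set_lebesgue_integral L A (g b) - set_lebesgue_integral L A (g (- b))"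
      using b D A by (simp add: g(2))
    also have "\<dots> = set_lebesgue_integral L A (\<lambda>x. a x \<bullet> b)"
      unfolding ab using sint D b by (intro set_integral_diff(2)[symmetric]) auto
    also have "\<dots> = set_lebesgue_integral L A a \<bullet> b"
      unfolding set_lebesgue_integral_def using integrable_mult_indicator[OF _ inta, of A] A
      by (simp flip: integral_inner_left)
    finally show "f A \<bullet> b = set_lebesgue_integral L A a \<bullet> b" .
  qed
  with finL inta show ?thesis
    by (intro that[of L a]) auto
qed

section \<open>Zonoids of integrable densities\<close>

text \<open>
  The Lorenz hull of the vector measure with density \<open>a\<close>. In the literature a zonoid is the range of
  a nonatomic vector measure, and the convex hull plays the part of nonatomicity here.
\<close>

definition zonoid :: "'a measure \<Rightarrow> ('a \<Rightarrow> 'e::euclidean_space) \<Rightarrow> 'e set" where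
  "zonoid L a = convex hull ((\<lambda>A. set_lebesgue_integral L A a) ` sets L)"

lemma set_integral_in_zonoid: "A \<in> sets L \<Longrightarrow> set_lebesgue_integral L A a \<in> zonoid L a"
  unfolding zonoid_def by (intro hull_inc) auto

lemma inner_set_integral:
  fixes a :: "'a \<Rightarrow> 'e::euclidean_space"
  assumes "integrable L a" "A \<in> sets L"
  shows "u \<bullet> set_lebesgue_integral L A a = (\<integral>x. indicator A x * (u \<bullet> a x) \<partial>L)"
proof -
  have "integrable L (\<lambda>x. indicator A x *\<^sub>R a x)"
    using assms by (intro integrable_mult_indicator)
  then have "u \<bullet> set_lebesgue_integral L A a = (\<integral>x. u \<bullet> (indicator A x *\<^sub>R a x) \<partial>L)"
    unfolding set_lebesgue_integral_def by (intro integral_inner_right[symmetric]) auto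
  then show ?thesis by simp
qed

lemma nn_integral_positive_part:
  fixes a :: "'a \<Rightarrow> 'e::euclidean_space"
  assumes "integrable L a"
  shows "(\<integral>\<^sup>+x. ennreal (u \<bullet> a x) \<partial>L) = ennreal (\<integral>x. max 0 (u \<bullet> a x) \<partial>L)"
proof -
  have "integrable L (\<lambda>x. max 0 (u \<bullet> a x))"
    using assms by (intro integrable_max) auto
  from nn_integral_eq_integral[OF this] show ?thesis
    by (simp add: ennreal_max_zero)
qed

text \<open>
  Together with \<open>zonoid_support_attained\<close>, this computes the support function of a zonoid. It is
  written as an integral of \<open>ennreal (u \<bullet> a x)\<close>, in which \<open>ennreal\<close> takes the positive part, so that
  Tonelli's theorem applies to it without integrability conditions.
\<close>

lemma zonoid_support_le:
  fixes a :: "'a \<Rightarrow> 'e::euclidean_space"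
  assumes a: "integrable L a" and y: "y \<in> zonoid L a"
  shows "ennreal (u \<bullet> y) \<le> (\<integral>\<^sup>+x. ennreal (u \<bullet> a x) \<partial>L)"
proof -
  let ?s = "\<integral>x. max 0 (u \<bullet> a x) \<partial>L"
  have "zonoid L a \<subseteq> {y. u \<bullet> y \<le> ?s}"
    unfolding zonoid_def
  proof (rule hull_minimal)
    have "u \<bullet> set_lebesgue_integral L A a \<le> ?s" if A: "A \<in> sets L" for A
      unfolding inner_set_integral[OF a A]
    proof (rule integral_mono)
      show "integrable L (\<lambda>x. indicator A x * (u \<bullet> a x))"
        using integrable_mult_indicator[OF A, of "\<lambda>x. u \<bullet> a x"] a by simp
      show "integrable L (\<lambda>x. max 0 (u \<bullet> a x))"
        using a by (intro integrable_max) auto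
    qed (auto split: split_indicator)
    then show "(\<lambda>A. set_lebesgue_integral L A a) ` sets L \<subseteq> {y. u \<bullet> y \<le> ?s}"
      by auto
  qed (rule convex_halfspace_le)
  with y have "u \<bullet> y \<le> ?s" by auto
  then show ?thesis
    unfolding nn_integral_positive_part[OF a] by (rule ennreal_leI)
qed

lemma zonoid_support_attained:
  fixes a :: "'a \<Rightarrow> 'e::euclidean_space"
  assumes a: "integrable L a"
  obtains y where "y \<in> zonoid L a" "(\<integral>\<^sup>+x. ennreal (u \<bullet> a x) \<partial>L) = ennreal (u \<bullet> y)"
proof -
  have [measurable]: "a \<in> borel_measurable L"
    using a by auto
  define P where "P = {x \<in> space L. 0 < u \<bullet> a x}"
  have P: "P \<in> sets L" unfolding P_def by measurable
  have "(\<integral>x. max 0 (u \<bullet> a x) \<partial>L) = u \<bullet> set_lebesgue_integral L P a"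
    unfolding inner_set_integral[OF a P]
    by (intro Bochner_Integration.integral_cong) (auto simp: P_def max_def split: split_indicator)
  then show ?thesis
    using that[OF set_integral_in_zonoid[OF P]] by (simp add: nn_integral_positive_part[OF a])
qed

text \<open>
  The induction runs over a subspace that contains the values of \<open>a\<close>. The zonoid of \<open>a0\<close>, the
  restriction of \<open>a\<close> to \<open>Z = {u \<bullet> a = 0}\<close>, is closed by the induction hypothesis, and its translate by
  \<open>p\<close>, the integral of \<open>a\<close> over \<open>N = {u \<bullet> a < 0}\<close>, is a part of the zonoid of \<open>a\<close>. The point is to
  show that a minimiser \<open>x\<close> of \<open>u \<bullet> _\<close> belongs to this translate.
\<close>

lemma closed_zonoid_subspace:
  fixes a :: "'a \<Rightarrow> 'e::euclidean_space"
  assumes "integrable L a" "subspace V" "\<And>x. x \<in> space L \<Longrightarrow> a x \<in> V"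
  shows "closed (zonoid L a)"
  using assms
proof (induction "dim V" arbitrary: a V rule: less_induct)
  case less
  note a = less.prems(1)
  have am[measurable]: "a \<in> borel_measurable L"
    using a by auto
  let ?K = "zonoid L a"
  have convK: "convex ?K" by (simp add: zonoid_def)
  have "x \<in> ?K" if x: "x \<in> closure ?K" for x
  proof (cases "x \<in> rel_interior ?K")
    case True
    then show ?thesis using rel_interior_subset by blast
  next
    case False
    obtain u where u: "\<And>y. y \<in> closure ?K \<Longrightarrow> u \<bullet> x \<le> u \<bullet> y"
      "\<And>y. y \<in> rel_interior ?K \<Longrightarrow> u \<bullet> x < u \<bullet> y"
      using supporting_hyperplane_relative_frontier[OF convK x False] by metis
    define N where "N = {x \<in> space L. u \<bullet> a x < 0}"
    define Z where "Z = {x \<in> space L. u \<bullet> a x = 0}"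
    have N[measurable]: "N \<in> sets L" unfolding N_def by measurable
    have Z[measurable]: "Z \<in> sets L" unfolding Z_def by measurable
    define a0 where "a0 = (\<lambda>x. indicator Z x *\<^sub>R a x)"
    have a0: "integrable L a0" unfolding a0_def using a Z by (intro integrable_mult_indicator)
    define p where "p = set_lebesgue_integral L N a"
    define V0 where "V0 = V \<inter> {v. u \<bullet> v = 0}"
    have V0: "subspace V0"
      unfolding V0_def using less.prems(2) subspace_hyperplane by (rule subspace_inter)
    \<comment> \<open>The functional is not constant on the zonoid, so the dimension really drops.\<close>
    have "\<exists>v\<in>V. u \<bullet> v \<noteq> 0"
    proof (rule ccontr)
      assume "\<not> ?thesis"
      then have z: "u \<bullet> a s = 0" if "s \<in> space L" for s
        using less.prems(3) that by auto
      have "u \<bullet> set_lebesgue_integral L A a = 0" if "A \<in> sets L" for A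
        unfolding inner_set_integral[OF a that]
        by (rule integral_eq_zero_AE) (use z in auto)
      then have "?K \<subseteq> {y. u \<bullet> y = 0}"
        unfolding zonoid_def by (intro hull_minimal convex_hyperplane) auto
      then have "closure ?K \<subseteq> {y. u \<bullet> y = 0}"
        by (rule closure_minimal) (rule closed_hyperplane)
      moreover obtain y where "y \<in> rel_interior ?K"
        using rel_interior_eq_empty[OF convK] set_integral_in_zonoid[OF N, of a] by blast
      moreover from this have "y \<in> closure ?K"
        using rel_interior_subset closure_subset by blast
      ultimately have "u \<bullet> y = 0" "u \<bullet> x = 0" "u \<bullet> x < u \<bullet> y"
        using u(2)[of y] x by blast+
      then show False by simp
    qed
    then have "V0 \<subset> V" by (auto simp: V0_def)
    then have "dim V0 < dim V"
      using V0 less.prems(2) by (intro dim_psubset) (simp add: span_eq_iff[THEN iffD2])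
    moreover have "a0 s \<in> V0" if "s \<in> space L" for s
      using less.prems(2,3) that subspace_0
      by (auto simp: a0_def V0_def Z_def split: split_indicator)
    ultimately have closed0: "closed (zonoid L a0)"
      using less.hyps a0 V0 by blast
    \<comment> \<open>Off \<open>Z\<close>, the size of \<open>a\<close> is at most \<open>n\<close> times that of \<open>u \<bullet> a\<close>, up to the tail \<open>h n\<close>.\<close>
    define h where "h n s = (if u \<bullet> a s \<noteq> 0 \<and> real n * \<bar>u \<bullet> a s\<bar> < norm (a s) then norm (a s) else 0)"
      for n s
    have hm[measurable]: "h n \<in> borel_measurable L" for n
      unfolding h_def by measurable
    have hint: "integrable L (h n)" for n
      by (rule Bochner_Integration.integrable_bound[OF a]) (auto simp: h_def)
    have "(\<lambda>n. integral\<^sup>L L (h n)) \<longlonglongrightarrow> (\<integral>s. 0 \<partial>L)"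
    proof (rule integral_dominated_convergence[where w = "\<lambda>s. norm (a s)"])
      have "(\<lambda>n. h n s) \<longlonglongrightarrow> 0" for s
      proof (cases "u \<bullet> a s = 0")
        case False
        then obtain m where m: "norm (a s) < real m * \<bar>u \<bullet> a s\<bar>"
          using reals_Archimedean3[of "\<bar>u \<bullet> a s\<bar>"] by auto
        have "h n s = 0" if "n \<ge> m" for n
        proof -
          have "real m * \<bar>u \<bullet> a s\<bar> \<le> real n * \<bar>u \<bullet> a s\<bar>"
            using that by (intro mult_right_mono) auto
          with m show ?thesis by (auto simp: h_def)
        qed
        then show ?thesis
          by (intro tendsto_eventually) (auto simp: eventually_sequentially)
      qed (simp add: h_def)
      then show "AE s in L. (\<lambda>n. h n s) \<longlonglongrightarrow> 0" by simp
    qed (use a in \<open>auto simp: h_def\<close>)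
    then have hlim: "(\<lambda>n. integral\<^sup>L L (h n)) \<longlonglongrightarrow> 0" by simp
    \<comment> \<open>For a measurable set \<open>A\<close>, integrating the previous bound over the set where \<open>A\<close> and \<open>N\<close> differ
      off \<open>Z\<close> compares \<open>A\<close> with \<open>N \<union> (A \<inter> Z)\<close>. Both sides of the resulting estimate behave well under
      convex combinations, hence it extends from the integrals to the whole zonoid.\<close>
    define Q where "Q n = {y. \<exists>w\<in>zonoid L a0. norm (y - p - w) \<le> real n * (u \<bullet> y - u \<bullet> p) + integral\<^sup>L L (h n)}"
      for n
    have KQ: "?K \<subseteq> Q n" for n
      unfolding zonoid_def[of L a]
    proof (rule hull_minimal)
      show "convex (Q n)"
      proof (rule convexI)
        fix y y' and c d :: real assume y: "y \<in> Q n" "y' \<in> Q n" and cd: "0 \<le> c" "0 \<le> d" "c + d = 1"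
        from y obtain w w' where w: "w \<in> zonoid L a0" "w' \<in> zonoid L a0"
          and le: "norm (y - p - w) \<le> real n * (u \<bullet> y - u \<bullet> p) + integral\<^sup>L L (h n)"
          "norm (y' - p - w') \<le> real n * (u \<bullet> y' - u \<bullet> p) + integral\<^sup>L L (h n)"
          by (auto simp: Q_def)
        have d: "d = 1 - c" using cd by simp
        have "(c *\<^sub>R y + d *\<^sub>R y') - p - (c *\<^sub>R w + d *\<^sub>R w') = c *\<^sub>R (y - p - w) + d *\<^sub>R (y' - p - w')"
          unfolding d by (simp add: algebra_simps)
        then have "norm ((c *\<^sub>R y + d *\<^sub>R y') - p - (c *\<^sub>R w + d *\<^sub>R w'))
            \<le> c * norm (y - p - w) + d * norm (y' - p - w')"
          using cd norm_triangle_ineq[of "c *\<^sub>R (y - p - w)" "d *\<^sub>R (y' - p - w')"] by simp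
        also have "\<dots> \<le> c * (real n * (u \<bullet> y - u \<bullet> p) + integral\<^sup>L L (h n))
            + d * (real n * (u \<bullet> y' - u \<bullet> p) + integral\<^sup>L L (h n))"
          using cd le by (intro add_mono mult_left_mono)
        also have "\<dots> = real n * (u \<bullet> (c *\<^sub>R y + d *\<^sub>R y') - u \<bullet> p) + integral\<^sup>L L (h n)"
          unfolding d by (simp add: algebra_simps inner_add_right)
        finally show "c *\<^sub>R y + d *\<^sub>R y' \<in> Q n"
          unfolding Q_def using w cd convexD[of "zonoid L a0" w w' c d]
          by (auto simp: zonoid_def intro!: bexI[of _ "c *\<^sub>R w + d *\<^sub>R w'"])
      qed
      show "(\<lambda>A. set_lebesgue_integral L A a) ` sets L \<subseteq> Q n"
      proof (clarify)
        fix A assume A[measurable]: "A \<in> sets L"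
        let ?c = "\<lambda>s. indicator A s - indicator N s - indicator A s * indicator Z s :: real"
        have iA: "integrable L (\<lambda>s. indicator B s *\<^sub>R b s)" if "B \<in> sets L" "integrable L b"
          for B and b :: "'a \<Rightarrow> 'e" using that by (rule integrable_mult_indicator)
        have iu: "integrable L (\<lambda>s. indicator B s * (u \<bullet> a s))" if "B \<in> sets L" for B
          using integrable_mult_indicator[OF that, of "\<lambda>x. u \<bullet> a x"] a by simp
        have ci: "integrable L (\<lambda>s. ?c s *\<^sub>R a s)"
          by (rule Bochner_Integration.integrable_bound[OF a]) (auto simp: N_def Z_def split: split_indicator)
        have "set_lebesgue_integral L A a - p - set_lebesgue_integral L A a0
            = (\<integral>s. indicator A s *\<^sub>R a s - indicator N s *\<^sub>R a s - indicator A s *\<^sub>R a0 s \<partial>L)"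
          unfolding p_def set_lebesgue_integral_def using iA a a0 by simp
        also have "\<dots> = (\<integral>s. ?c s *\<^sub>R a s \<partial>L)"
          by (simp add: a0_def scaleR_diff_left)
        also have "norm \<dots> \<le> (\<integral>s. norm (?c s *\<^sub>R a s) \<partial>L)"
          by (rule integral_norm_bound)
        also have "\<dots> \<le> (\<integral>s. real n * (indicator A s * (u \<bullet> a s) - indicator N s * (u \<bullet> a s)) + h n s \<partial>L)"
        proof (rule integral_mono)
          fix s assume "s \<in> space L"
          then show "norm (?c s *\<^sub>R a s) \<le> real n * (indicator A s * (u \<bullet> a s) - indicator N s * (u \<bullet> a s)) + h n s"
            by (auto simp: h_def N_def Z_def not_less mult_le_0_iff split: split_indicator)
        qed (use ci[THEN integrable_norm] iu hint in auto)
        also have "\<dots> = real n * (u \<bullet> set_lebesgue_integral L A a - u \<bullet> p) + integral\<^sup>L L (h n)"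
          unfolding p_def inner_set_integral[OF a A] inner_set_integral[OF a N]
          using iu hint by simp
        finally show "set_lebesgue_integral L A a \<in> Q n"
          unfolding Q_def using set_integral_in_zonoid[OF A, of a0] by blast
      qed
    qed
    have xp: "u \<bullet> x \<le> u \<bullet> p"
      unfolding p_def using set_integral_in_zonoid[OF N, of a] closure_subset by (intro u(1)) auto
    have "x - p \<in> closure (zonoid L a0)"
      unfolding closure_approachable
    proof (intro allI impI)
      fix e :: real assume e: "e > 0"
      obtain n where n: "integral\<^sup>L L (h n) < e / 2"
        using order_tendstoD(2)[OF hlim, of "e/2"] e by (auto simp: eventually_sequentially)
      \<comment> \<open>The number \<open>n\<close> is fixed before \<open>y\<close> is taken close to \<open>x\<close>, so that the factor \<open>n\<close> is harmless.\<close>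
      define d where "d = e / (2 * (real n * norm u + 1))"
      have pos: "0 < real n * norm u + 1" 
        by (intro add_nonneg_pos) auto
      then have "d > 0" using e by (simp add: d_def)
      then obtain y where y: "y \<in> ?K" "dist y x < d"
        using x unfolding closure_approachable by blast
      then obtain w where w: "w \<in> zonoid L a0"
        and le: "norm (y - p - w) \<le> real n * (u \<bullet> y - u \<bullet> p) + integral\<^sup>L L (h n)"
        using KQ[of n] by (auto simp: Q_def)
      have "u \<bullet> y - u \<bullet> p \<le> u \<bullet> (y - x)"
        using xp by (simp add: inner_diff_right)
      also have "\<dots> \<le> norm u * dist y x"
        by (metis dist_norm norm_cauchy_schwarz)
      finally have "real n * (u \<bullet> y - u \<bullet> p) \<le> real n * (norm u * dist y x)"
        by (intro mult_left_mono) auto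
      then have "dist y x + norm (y - p - w) \<le> (real n * norm u + 1) * dist y x + integral\<^sup>L L (h n)"
        using le by (simp add: algebra_simps)
      also have "\<dots> < (real n * norm u + 1) * d + e / 2"
        using y(2) pos n by (intro add_strict_mono mult_strict_left_mono)
      also have "(real n * norm u + 1) * d = e / 2"
        using pos by (simp add: d_def field_simps)
      finally have "dist y x + norm (y - p - w) < e" by simp
      moreover have "dist w (x - p) \<le> dist y x + norm (y - p - w)"
        using norm_triangle_ineq4[of "y - x" "y - p - w"]
        by (simp add: dist_norm algebra_simps)
      ultimately show "\<exists>w\<in>zonoid L a0. dist w (x - p) < e"
        using w by (intro bexI[of _ w]) auto
    qed
    then have "x - p \<in> zonoid L a0" using closed0 by simp
    then have "x \<in> (\<lambda>w. p + w) ` zonoid L a0"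
      by (intro image_eqI[of _ _ "x - p"]) auto
    also have "\<dots> \<subseteq> ?K"
      unfolding zonoid_def[of L a0] convex_hull_translation[symmetric]
    proof (rule hull_minimal)
      show "(\<lambda>w. p + w) ` (\<lambda>A. set_lebesgue_integral L A a0) ` sets L \<subseteq> ?K"
      proof clarify
        fix A assume A: "A \<in> sets L"
        have "p + set_lebesgue_integral L A a0
            = (\<integral>s. indicator N s *\<^sub>R a s + indicator A s *\<^sub>R a0 s \<partial>L)"
          unfolding p_def set_lebesgue_integral_def
          using integrable_mult_indicator[OF N a] integrable_mult_indicator[OF A a0] by simp
        also have "\<dots> = set_lebesgue_integral L (N \<union> (A \<inter> Z)) a"
          unfolding set_lebesgue_integral_def
          by (intro Bochner_Integration.integral_cong)
            (auto simp: a0_def N_def Z_def split: split_indicator)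
        also have "\<dots> \<in> ?K"
          using A N Z by (intro set_integral_in_zonoid) auto
        finally show "p + set_lebesgue_integral L A a0 \<in> ?K" .
      qed
    qed (rule convK)
    finally show ?thesis .
  qed
  then show "closed ?K"
    using closure_subset_eq by blast
qed

lemma closed_zonoid:
  fixes a :: "'a \<Rightarrow> 'e::euclidean_space"
  assumes "integrable L a"
  shows "closed (zonoid L a)"
  using closed_zonoid_subspace[OF assms subspace_UNIV] by simp

text \<open>
  Since zonoids are closed, a point outside one is strictly separated from it, and the separating
  functional violates the inequality of support functions.
\<close>

theorem zonoid_subset_iff:
  fixes a :: "'a \<Rightarrow> 'e::euclidean_space" and a' :: "'b \<Rightarrow> 'e"
  assumes a: "integrable L a" and a': "integrable L' a'"
  shows "zonoid L a \<subseteq> zonoid L' a' \<longleftrightarrow>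
    (\<forall>u. (\<integral>\<^sup>+x. ennreal (u \<bullet> a x) \<partial>L) \<le> (\<integral>\<^sup>+x. ennreal (u \<bullet> a' x) \<partial>L'))"
proof (intro iffI allI)
  fix u assume sub: "zonoid L a \<subseteq> zonoid L' a'"
  obtain y where y: "y \<in> zonoid L a" "(\<integral>\<^sup>+x. ennreal (u \<bullet> a x) \<partial>L) = ennreal (u \<bullet> y)"
    by (rule zonoid_support_attained[OF a])
  show "(\<integral>\<^sup>+x. ennreal (u \<bullet> a x) \<partial>L) \<le> (\<integral>\<^sup>+x. ennreal (u \<bullet> a' x) \<partial>L')"
    unfolding y(2) using sub y(1) by (intro zonoid_support_le[OF a']) auto
next
  assume le: "\<forall>u. (\<integral>\<^sup>+x. ennreal (u \<bullet> a x) \<partial>L) \<le> (\<integral>\<^sup>+x. ennreal (u \<bullet> a' x) \<partial>L')"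
  show "zonoid L a \<subseteq> zonoid L' a'"
  proof (rule subsetI, rule ccontr)
    fix z assume z: "z \<in> zonoid L a" "z \<notin> zonoid L' a'"
    have "convex (zonoid L' a')" by (simp add: zonoid_def)
    then obtain v b where v: "v \<bullet> z < b" "\<And>x. x \<in> zonoid L' a' \<Longrightarrow> b < v \<bullet> x"
      using separating_hyperplane_closed_point[OF _ closed_zonoid[OF a'] z(2)] by blast
    obtain y where y: "y \<in> zonoid L' a'" "(\<integral>\<^sup>+x. ennreal (- v \<bullet> a' x) \<partial>L') = ennreal (- v \<bullet> y)"
      by (rule zonoid_support_attained[OF a'])
    have "ennreal (- v \<bullet> z) \<le> ennreal (- v \<bullet> y)"
      using zonoid_support_le[OF a z(1), of "- v"] le y(2) order_trans by metis
    \<comment> \<open>The zonoid contains \<open>0\<close>, so the truncation at \<open>0\<close> hides nothing at \<open>z\<close>.\<close>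
    moreover have "0 < - v \<bullet> z"
    proof -
      have "set_lebesgue_integral L' {} a' = 0" by (simp add: set_lebesgue_integral_def)
      then have "b < 0" using v(2)[OF set_integral_in_zonoid[of "{}" L' a']] by simp
      with v(1) show ?thesis by simp
    qed
    ultimately have "- v \<bullet> z \<le> - v \<bullet> y"
      by (simp add: ennreal_le_iff2)
    with v(1) v(2)[OF y(1)] show False by simp
  qed
qed

section \<open>Densities of product measures\<close>

lemma sigma_additive_set_integral:
  fixes a :: "'a \<Rightarrow> 'b::{banach, second_countable_topology}"
  assumes a: "integrable L a"
  shows "sigma_additive L (\<lambda>A. set_lebesgue_integral L A a)"
  unfolding sigma_additive_def sums_def
proof (intro allI impI)
  fix A :: "nat \<Rightarrow> 'a set"
  assume A: "range A \<subseteq> sets L" "disjoint_family A"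
  have int: "set_integrable L B a" if "B \<in> sets L" for B
    unfolding set_integrable_def using a that by (intro integrable_mult_indicator)
  have "(\<lambda>n. set_lebesgue_integral L (\<Union>i<n. A i) a) \<longlonglongrightarrow>
      set_lebesgue_integral L (\<Union>n. \<Union>i<n. A i) a"
    using A int by (intro set_integral_cont_up) (auto simp: incseq_def intro: less_le_trans)
  also have "(\<Union>n. \<Union>i<n. A i) = (\<Union>i. A i)" by auto
  also have "(\<lambda>n. set_lebesgue_integral L (\<Union>i<n. A i) a) = (\<lambda>n. \<Sum>i<n. set_lebesgue_integral L (A i) a)"
    using A int by (intro ext set_integral_finite_Union) (auto simp: disjoint_family_on_def)
  finally show "(\<lambda>n. \<Sum>i<n. set_lebesgue_integral L (A i) a) \<longlonglongrightarrow> set_lebesgue_integral L (\<Union>i. A i) a" .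
qed

lemma sigma_additive_cong:
  assumes "sets M = sets N" "\<And>A. A \<in> sets M \<Longrightarrow> f A = g A"
  shows "sigma_additive M f \<longleftrightarrow> sigma_additive N g"
proof -
  have "(\<lambda>i. f (A i)) = (\<lambda>i. g (A i)) \<and> f (\<Union>i. A i) = g (\<Union>i. A i)"
    if "range A \<subseteq> sets M" for A :: "nat \<Rightarrow> 'a set"
  proof -
    have "A i \<in> sets M" for i using that by auto
    then show ?thesis using assms(2) by auto
  qed
  then show ?thesis
    unfolding sigma_additive_def assms(1)[symmetric] by (metis (no_types, lifting))
qed

text \<open>
  Rectangles form an intersection-stable generator, and the sets on which two sigma-additive
  functions agree are closed under complements and disjoint countable unions.
\<close>

lemma sigma_additive_eq_on_pair_measure:
  assumes f: "sigma_additive (M \<Otimes>\<^sub>M N) f" and g: "sigma_additive (M \<Otimes>\<^sub>M N) g"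
    and eq: "\<And>A B. A \<in> sets M \<Longrightarrow> B \<in> sets N \<Longrightarrow> f (A \<times> B) = g (A \<times> B)"
    and C: "C \<in> sets (M \<Otimes>\<^sub>M N)"
  shows "f C = g C"
  using Int_stable_pair_measure_generator pair_measure_closed C
  unfolding sets_pair_measure
proof (induct rule: sigma_sets_induct_disjoint)
  case (basic C)
  then show ?case using eq by auto
next
  case empty
  show ?case using sigma_additive_empty[OF f] sigma_additive_empty[OF g] by simp
next
  case (compl C)
  then have C: "C \<in> sets (M \<Otimes>\<^sub>M N)" by (simp add: sets_pair_measure)
  have top: "space M \<times> space N \<in> sets (M \<Otimes>\<^sub>M N)" by auto
  have sub: "C \<subseteq> space M \<times> space N"
    using sets.sets_into_space[OF C] by (simp add: space_pair_measure)
  show ?case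
    using compl eq[OF sets.top sets.top]
    by (simp add: sigma_additive_Diff[OF f top C sub] sigma_additive_Diff[OF g top C sub])
next
  case (union C)
  have "range C \<subseteq> sets (M \<Otimes>\<^sub>M N)"
    using union by (simp add: sets_pair_measure)
  then have "(\<lambda>i. f (C i)) sums f (\<Union>i. C i)" "(\<lambda>i. g (C i)) sums g (\<Union>i. C i)"
    using union(1) by (auto intro!: sigma_additiveD[OF f] sigma_additiveD[OF g])
  moreover have "(\<lambda>i. f (C i)) = (\<lambda>i. g (C i))" using union by auto
  ultimately show ?case by (simp add: sums_unique2)
qed

text \<open>
  Stated for bilinear maps to cover both the product of complex numbers and the componentwise product
  of vectors.
\<close>

lemma integrable_bilinear_pair:
  fixes a :: "'a \<Rightarrow> 'x::{banach, second_countable_topology}"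
    and b :: "'b \<Rightarrow> 'y::{banach, second_countable_topology}"
    and H :: "'x \<Rightarrow> 'y \<Rightarrow> 'z::{banach, second_countable_topology}"
  assumes H: "bounded_bilinear H" and L: "sigma_finite_measure L'"
    and a: "integrable L a" and b: "integrable L' b"
  shows "integrable (L \<Otimes>\<^sub>M L') (\<lambda>z. H (a (fst z)) (b (snd z)))"
proof (rule integrableI_bounded)
  interpret L': sigma_finite_measure L' by fact
  have [measurable]: "a \<in> borel_measurable L" "b \<in> borel_measurable L'"
    using a b by auto
  have cont: "continuous_on UNIV (\<lambda>z. H (fst z) (snd z))"
    by (intro bounded_bilinear.continuous_on[OF H] continuous_intros)
  show [measurable]: "(\<lambda>z. H (a (fst z)) (b (snd z))) \<in> borel_measurable (L \<Otimes>\<^sub>M L')"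
    by (rule borel_measurable_continuous_Pair[OF _ _ cont]) measurable
  obtain K where K: "0 < K" "\<And>x y. norm (H x y) \<le> norm x * norm y * K"
    using bounded_bilinear.pos_bounded[OF H] by blast
  have "(\<integral>\<^sup>+z. ennreal (norm (H (a (fst z)) (b (snd z)))) \<partial>(L \<Otimes>\<^sub>M L'))
      \<le> (\<integral>\<^sup>+z. ennreal (norm (a (fst z))) * (ennreal (norm (b (snd z))) * ennreal K) \<partial>(L \<Otimes>\<^sub>M L'))"
    using K by (intro nn_integral_mono) (auto simp: ennreal_mult'[symmetric] mult.assoc[symmetric] intro!: ennreal_leI)
  also have "\<dots> = (\<integral>\<^sup>+x. (\<integral>\<^sup>+y. ennreal (norm (a x)) * (ennreal (norm (b y)) * ennreal K) \<partial>L') \<partial>L)"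
    by (subst L'.nn_integral_fst[symmetric]) simp_all
  also have "\<dots> = (\<integral>\<^sup>+x. ennreal (norm (a x)) \<partial>L) * ((\<integral>\<^sup>+y. ennreal (norm (b y)) \<partial>L') * ennreal K)"
    by (simp add: nn_integral_cmult nn_integral_multc)
  also have "\<dots> < \<infinity>"
    using a b unfolding integrable_iff_bounded by (simp add: ennreal_mult_less_top)
  finally show "(\<integral>\<^sup>+z. ennreal (norm (H (a (fst z)) (b (snd z)))) \<partial>(L \<Otimes>\<^sub>M L')) < \<infinity>" .
qed

lemma set_integral_times:
  fixes a :: "'a \<Rightarrow> complex" and b :: "'b \<Rightarrow> complex"
  assumes L: "sigma_finite_measure L" and L': "sigma_finite_measure L'"
    and a: "integrable L a" and b: "integrable L' b" and A: "A \<in> sets L" and B: "B \<in> sets L'"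
  shows "set_lebesgue_integral (L \<Otimes>\<^sub>M L') (A \<times> B) (\<lambda>z. a (fst z) * b (snd z))
    = set_lebesgue_integral L A a * set_lebesgue_integral L' B b"
proof -
  interpret pair_sigma_finite L L'
    using L L' by (simp add: pair_sigma_finite_def)
  let ?f = "\<lambda>z. indicator (A \<times> B) z *\<^sub>R (a (fst z) * b (snd z))"
  have int: "integrable (L \<Otimes>\<^sub>M L') ?f"
    using A B integrable_bilinear_pair[OF bounded_bilinear_mult L' a b]
    by (intro integrable_mult_indicator) auto
  have f: "?f (x, y) = (indicator A x *\<^sub>R a x) * (indicator B y *\<^sub>R b y)" for x y
    by (simp add: indicator_times)
  have "set_lebesgue_integral (L \<Otimes>\<^sub>M L') (A \<times> B) (\<lambda>z. a (fst z) * b (snd z)) = integral\<^sup>L (L \<Otimes>\<^sub>M L') ?f"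
    by (simp add: set_lebesgue_integral_def)
  also have "\<dots> = (\<integral>x. (\<integral>y. ?f (x, y) \<partial>L') \<partial>L)"
    by (rule integral_fst'[OF int, symmetric])
  also have "\<dots> = (\<integral>x. (\<integral>y. (indicator A x *\<^sub>R a x) * (indicator B y *\<^sub>R b y) \<partial>L') \<partial>L)"
    by (simp only: f)
  also have "\<dots> = set_lebesgue_integral L A a * set_lebesgue_integral L' B b"
    by (simp only: set_lebesgue_integral_def integral_mult_left_zero integral_mult_right_zero)
  finally show ?thesis .
qed

text \<open>
  The density measure shows that a product measure exists, and agreement on rectangles shows that it
  is the only one, so the definite description picks it out.
\<close>

lemma complex_prod_measure_density:
  assumes L: "sigma_finite_measure L" and L': "sigma_finite_measure L'"
    and M[measurable_cong]: "sets M = sets L" and N[measurable_cong]: "sets N = sets L'"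
    and a: "integrable L a" and b: "integrable L' b"
    and \<alpha>: "\<And>A. A \<in> sets M \<Longrightarrow> \<alpha> A = set_lebesgue_integral L A a"
    and \<beta>: "\<And>B. B \<in> sets N \<Longrightarrow> \<beta> B = set_lebesgue_integral L' B b"
    and C: "C \<in> sets (M \<Otimes>\<^sub>M N)"
  shows "complex_prod_measure M \<alpha> N \<beta> C
    = set_lebesgue_integral (L \<Otimes>\<^sub>M L') C (\<lambda>z. a (fst z) * b (snd z))"
proof -
  define \<gamma> where "\<gamma> = restrict (\<lambda>C. set_lebesgue_integral (L \<Otimes>\<^sub>M L') C (\<lambda>z. a (fst z) * b (snd z)))
    (sets (M \<Otimes>\<^sub>M N))"
  have sets: "sets (M \<Otimes>\<^sub>M N) = sets (L \<Otimes>\<^sub>M L')"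
    using M N by (rule sets_pair_measure_cong)
  have cm: "complex_measure K f \<longleftrightarrow> sigma_additive K f" for K :: "('a \<times> 'b) measure" and f
    by (simp add: complex_measure_def sigma_additive_def)
  have add: "sigma_additive (M \<Otimes>\<^sub>M N) \<gamma>"
    using sigma_additive_set_integral[OF integrable_bilinear_pair[OF bounded_bilinear_mult L' a b]]
    by (subst sigma_additive_cong[OF sets]) (auto simp: \<gamma>_def)
  have rect: "\<gamma> (A \<times> B) = \<alpha> A * \<beta> B" if "A \<in> sets M" "B \<in> sets N" for A B
    using that set_integral_times[OF L L' a b, of A B] M N by (simp add: \<gamma>_def \<alpha> \<beta>)
  have "complex_prod_measure M \<alpha> N \<beta> = \<gamma>"
    unfolding complex_prod_measure_def
  proof (rule the_equality, intro conjI ballI)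
    show "\<gamma> \<in> extensional (sets (M \<Otimes>\<^sub>M N))" by (simp add: \<gamma>_def)
    show "complex_measure (M \<Otimes>\<^sub>M N) \<gamma>" using add by (simp only: cm)
    show "\<gamma> (A \<times> B) = \<alpha> A * \<beta> B" if "A \<in> sets M" "B \<in> sets N" for A B
      using rect that .
  next
    fix \<delta> assume \<delta>: "\<delta> \<in> extensional (sets (M \<Otimes>\<^sub>M N)) \<and> complex_measure (M \<Otimes>\<^sub>M N) \<delta> \<and>
        (\<forall>A\<in>sets M. \<forall>B\<in>sets N. \<delta> (A \<times> B) = \<alpha> A * \<beta> B)"
    have "sigma_additive (M \<Otimes>\<^sub>M N) \<delta>" using \<delta> by (simp only: cm)
    moreover have "\<delta> (A \<times> B) = \<gamma> (A \<times> B)" if "A \<in> sets M" "B \<in> sets N" for A B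
      using \<delta> that rect[OF that] by metis
    ultimately have "\<delta> C = \<gamma> C" if "C \<in> sets (M \<Otimes>\<^sub>M N)" for C
      using sigma_additive_eq_on_pair_measure[OF _ add _ that] by blast
    moreover have "\<gamma> \<in> extensional (sets (M \<Otimes>\<^sub>M N))" by (simp add: \<gamma>_def)
    ultimately show "\<delta> = \<gamma>"
      using \<delta> by (intro extensionalityI[of \<delta> "sets (M \<Otimes>\<^sub>M N)" \<gamma>]) blast+
  qed
  then show ?thesis using C by (simp add: \<gamma>_def)
qed

section \<open>Lorenz hulls of products\<close>

lemma bounded_bilinear_vec_times: "bounded_bilinear ((*) :: complex ^ 'n \<Rightarrow> complex ^ 'n \<Rightarrow> complex ^ 'n)"
proof
  show "\<exists>K. \<forall>v w :: complex ^ 'n. norm (v * w) \<le> norm v * norm w * K"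
  proof (intro exI allI)
    fix v w :: "complex ^ 'n"
    have "norm (v * w) \<le> (\<Sum>i\<in>UNIV. norm ((v * w) $ i))"
      unfolding norm_vec_def by (rule L2_set_le_sum) simp
    also have "\<dots> \<le> (\<Sum>i\<in>(UNIV :: 'n set). norm v * norm w)"
      by (intro sum_mono) (simp add: norm_mult mult_mono Finite_Cartesian_Product.norm_nth_le)
    finally show "norm (v * w) \<le> norm v * norm w * real CARD('n)"
      by (simp add: mult.commute)
  qed
qed (simp_all add: vec_eq_iff algebra_simps)

definition cnj_vec :: "complex ^ 'n \<Rightarrow> complex ^ 'n" where
  "cnj_vec v = (\<chi> i. cnj (v $ i))"

text \<open>
  Freezing one factor of a componentwise product turns a functional on the product into a functional
  on the other factor. This adjoint is the reason why the componentwise product is monotone.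
\<close>

lemma inner_vec_times: "u \<bullet> (v * w) = (u * cnj_vec w) \<bullet> v" for u v w :: "complex ^ 'n"
  unfolding inner_vec_def
  by (intro sum.cong) (simp_all add: cnj_vec_def inner_complex_def algebra_simps)

lemma vector_complex_measure_iff_sigma_additive:
  "vector_complex_measure M \<alpha> \<longleftrightarrow> sigma_additive M \<alpha>" for \<alpha> :: "'a set \<Rightarrow> complex ^ 'n"
proof
  assume "vector_complex_measure M \<alpha>"
  then show "sigma_additive M \<alpha>"
    unfolding vector_complex_measure_def complex_measure_def sigma_additive_def sums_def
    by (auto intro!: vec_tendstoI simp: sum_component)
next
  assume "sigma_additive M \<alpha>"
  from sigma_additive_bounded_linear[OF bounded_linear_vec_nth this]
  show "vector_complex_measure M \<alpha>"
    by (simp add: vector_complex_measure_def complex_measure_def sigma_additive_def)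
qed

lemma set_integral_vec_nth:
  fixes a :: "'a \<Rightarrow> complex ^ 'n"
  assumes "integrable L a" "A \<in> sets L"
  shows "set_lebesgue_integral L A a $ i = set_lebesgue_integral L A (\<lambda>x. a x $ i)"
  using integral_bounded_linear[OF bounded_linear_vec_nth[of i] integrable_mult_indicator[OF assms(2,1)]]
  by (simp add: set_lebesgue_integral_def)

lemma lorenz_hull_eq_zonoid:
  assumes "sets L = sets M" "\<And>A. A \<in> sets M \<Longrightarrow> \<alpha> A = set_lebesgue_integral L A a"
  shows "lorenz_hull M \<alpha> = zonoid L a"
  unfolding lorenz_hull_def zonoid_def using assms by (simp cong: image_cong)

lemma lorenz_hull_vector_prod_measure:
  fixes a :: "'a \<Rightarrow> complex ^ 'n" and b :: "'b \<Rightarrow> complex ^ 'n"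
  assumes L: "sigma_finite_measure L" and L': "sigma_finite_measure L'"
    and M: "sets L = sets M" and N: "sets L' = sets N"
    and a: "integrable L a" and b: "integrable L' b"
    and \<alpha>: "\<And>A. A \<in> sets M \<Longrightarrow> \<alpha> A = set_lebesgue_integral L A a"
    and \<beta>: "\<And>B. B \<in> sets N \<Longrightarrow> \<beta> B = set_lebesgue_integral L' B b"
  shows "lorenz_hull (M \<Otimes>\<^sub>M N) (vector_prod_measure M \<alpha> N \<beta>)
    = zonoid (L \<Otimes>\<^sub>M L') (\<lambda>z. a (fst z) * b (snd z))"
proof (rule lorenz_hull_eq_zonoid)
  show sets: "sets (L \<Otimes>\<^sub>M L') = sets (M \<Otimes>\<^sub>M N)"
    using M N by (rule sets_pair_measure_cong)
  fix C assume C: "C \<in> sets (M \<Otimes>\<^sub>M N)"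
  have ai: "integrable L (\<lambda>x. a x $ i)" "integrable L' (\<lambda>y. b y $ i)" for i
    using integrable_bounded_linear[OF bounded_linear_vec_nth] a b by blast+
  have "vector_prod_measure M \<alpha> N \<beta> C $ i
      = set_lebesgue_integral (L \<Otimes>\<^sub>M L') C (\<lambda>z. a (fst z) $ i * b (snd z) $ i)" for i
    unfolding vector_prod_measure_def vec_lambda_beta
    by (intro complex_prod_measure_density[OF L L' M[symmetric] N[symmetric] ai(1) ai(2) _ _ C])
      (auto simp: \<alpha> \<beta> M N set_integral_vec_nth[OF a] set_integral_vec_nth[OF b])
  also have "\<dots> i = set_lebesgue_integral (L \<Otimes>\<^sub>M L') C (\<lambda>z. a (fst z) * b (snd z)) $ i" for i
    using integrable_bilinear_pair[OF bounded_bilinear_vec_times L' a b] C sets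
    by (simp add: set_integral_vec_nth)
  finally show "vector_prod_measure M \<alpha> N \<beta> C
      = set_lebesgue_integral (L \<Otimes>\<^sub>M L') C (\<lambda>z. a (fst z) * b (snd z))"
    by (simp add: vec_eq_iff)
qed

text \<open>
  Tonelli's theorem in both orders: for a fixed point of one factor, the inner integral is a value of
  the support function of the zonoid of the other factor.
\<close>

lemma support_of_product_density:
  fixes a :: "'a \<Rightarrow> complex ^ 'n" and b :: "'b \<Rightarrow> complex ^ 'n"
  assumes L: "sigma_finite_measure L" and L': "sigma_finite_measure L'"
    and a: "integrable L a" and b: "integrable L' b"
  shows "(\<integral>\<^sup>+z. ennreal (u \<bullet> (a (fst z) * b (snd z))) \<partial>(L \<Otimes>\<^sub>M L'))
      = (\<integral>\<^sup>+y. (\<integral>\<^sup>+x. ennreal ((u * cnj_vec (b y)) \<bullet> a x) \<partial>L) \<partial>L')"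
    and "(\<integral>\<^sup>+z. ennreal (u \<bullet> (a (fst z) * b (snd z))) \<partial>(L \<Otimes>\<^sub>M L'))
      = (\<integral>\<^sup>+x. (\<integral>\<^sup>+y. ennreal ((u * cnj_vec (a x)) \<bullet> b y) \<partial>L') \<partial>L)"
proof -
  interpret pair_sigma_finite L L'
    using L L' by (simp add: pair_sigma_finite_def)
  let ?f = "\<lambda>z. ennreal (u \<bullet> (a (fst z) * b (snd z)))"
  have [measurable]: "(\<lambda>z. a (fst z) * b (snd z)) \<in> borel_measurable (L \<Otimes>\<^sub>M L')"
    using integrable_bilinear_pair[OF bounded_bilinear_vec_times L' a b] by auto
  have f: "?f \<in> borel_measurable (L \<Otimes>\<^sub>M L')" by measurable
  have comm: "v * w = w * v" for v w :: "complex ^ 'n"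
    by (simp add: vec_eq_iff mult.commute)
  show "integral\<^sup>N (L \<Otimes>\<^sub>M L') ?f = (\<integral>\<^sup>+y. (\<integral>\<^sup>+x. ennreal ((u * cnj_vec (b y)) \<bullet> a x) \<partial>L) \<partial>L')"
    using nn_integral_snd[OF f] by (simp add: inner_vec_times)
  have "u \<bullet> (a x * b y) = (u * cnj_vec (a x)) \<bullet> b y" for x y
    using inner_vec_times[of u "b y" "a x"] by (simp add: comm[of "a x"])
  then show "integral\<^sup>N (L \<Otimes>\<^sub>M L') ?f = (\<integral>\<^sup>+x. (\<integral>\<^sup>+y. ennreal ((u * cnj_vec (a x)) \<bullet> b y) \<partial>L') \<partial>L)"
    using M2.nn_integral_fst[OF f] by simp
qed

text \<open>
  The chain goes through the mixed product of \<open>a'\<close> and \<open>b\<close>, changing one factor at a time. Integration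
  over the unchanged factor preserves the inequality of support functions.
\<close>

lemma zonoid_product_mono:
  fixes a :: "'a \<Rightarrow> complex ^ 'n" and a' :: "'b \<Rightarrow> complex ^ 'n"
    and b :: "'c \<Rightarrow> complex ^ 'n" and b' :: "'d \<Rightarrow> complex ^ 'n"
  assumes sf: "sigma_finite_measure L" "sigma_finite_measure L'"
      "sigma_finite_measure K" "sigma_finite_measure K'"
    and a: "integrable L a" and a': "integrable L' a'"
    and b: "integrable K b" and b': "integrable K' b'"
    and sub_a: "zonoid L a \<subseteq> zonoid L' a'" and sub_b: "zonoid K b \<subseteq> zonoid K' b'"
  shows "zonoid (L \<Otimes>\<^sub>M K) (\<lambda>z. a (fst z) * b (snd z))
    \<subseteq> zonoid (L' \<Otimes>\<^sub>M K') (\<lambda>z. a' (fst z) * b' (snd z))"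
proof (subst zonoid_subset_iff)
  show "integrable (L \<Otimes>\<^sub>M K) (\<lambda>z. a (fst z) * b (snd z))"
    "integrable (L' \<Otimes>\<^sub>M K') (\<lambda>z. a' (fst z) * b' (snd z))"
    using sf by (auto intro!: integrable_bilinear_pair[OF bounded_bilinear_vec_times] a b a' b')
  have le_a: "(\<integral>\<^sup>+x. ennreal (v \<bullet> a x) \<partial>L) \<le> (\<integral>\<^sup>+x. ennreal (v \<bullet> a' x) \<partial>L')" for v
    using sub_a zonoid_subset_iff[OF a a'] by blast
  have le_b: "(\<integral>\<^sup>+y. ennreal (v \<bullet> b y) \<partial>K) \<le> (\<integral>\<^sup>+y. ennreal (v \<bullet> b' y) \<partial>K')" for v
    using sub_b zonoid_subset_iff[OF b b'] by blast
  show "\<forall>u. (\<integral>\<^sup>+z. ennreal (u \<bullet> (a (fst z) * b (snd z))) \<partial>(L \<Otimes>\<^sub>M K))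
      \<le> (\<integral>\<^sup>+z. ennreal (u \<bullet> (a' (fst z) * b' (snd z))) \<partial>(L' \<Otimes>\<^sub>M K'))"
  proof
    fix u
    have "(\<integral>\<^sup>+z. ennreal (u \<bullet> (a (fst z) * b (snd z))) \<partial>(L \<Otimes>\<^sub>M K))
        \<le> (\<integral>\<^sup>+z. ennreal (u \<bullet> (a' (fst z) * b (snd z))) \<partial>(L' \<Otimes>\<^sub>M K))"
      by (simp only: support_of_product_density(1) sf a a' b)
        (intro nn_integral_mono le_a)
    also have "\<dots> \<le> (\<integral>\<^sup>+z. ennreal (u \<bullet> (a' (fst z) * b' (snd z))) \<partial>(L' \<Otimes>\<^sub>M K'))"
      by (simp only: support_of_product_density(2) sf a' b b')
        (intro nn_integral_mono le_b)
    finally show "(\<integral>\<^sup>+z. ennreal (u \<bullet> (a (fst z) * b (snd z))) \<partial>(L \<Otimes>\<^sub>M K))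
      \<le> (\<integral>\<^sup>+z. ennreal (u \<bullet> (a' (fst z) * b' (snd z))) \<partial>(L' \<Otimes>\<^sub>M K'))" .
  qed
qed

theorem proposition20:
  fixes M :: "'a measure" and M' :: "'b measure" and N :: "'c measure" and N' :: "'d measure"
    and \<alpha> :: "'a set \<Rightarrow> complex ^ 'n" and \<alpha>' :: "'b set \<Rightarrow> complex ^ 'n"
    and \<beta> :: "'c set \<Rightarrow> complex ^ 'n" and \<beta>' :: "'d set \<Rightarrow> complex ^ 'n"
  assumes "vector_complex_measure M \<alpha>" and "vector_complex_measure M' \<alpha>'"
    and "vector_complex_measure N \<beta>" and "vector_complex_measure N' \<beta>'"
    and "lorenz_hull M \<alpha> \<subseteq> lorenz_hull M' \<alpha>'"
    and "lorenz_hull N \<beta> \<subseteq> lorenz_hull N' \<beta>'"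
  shows "lorenz_hull (M \<Otimes>\<^sub>M N) (vector_prod_measure M \<alpha> N \<beta>)
       \<subseteq> lorenz_hull (M' \<Otimes>\<^sub>M N') (vector_prod_measure M' \<alpha>' N' \<beta>')"
proof -
  note sa = assms(1-4)[unfolded vector_complex_measure_iff_sigma_additive]
  note sf = finite_measure.axioms(1)
  obtain L a where a: "finite_measure L" "sets L = sets M" "integrable L a"
    "\<And>A. A \<in> sets M \<Longrightarrow> \<alpha> A = set_lebesgue_integral L A a"
    using sigma_additive_density[OF sa(1)] by blast
  obtain L' a' where a': "finite_measure L'" "sets L' = sets M'" "integrable L' a'"
    "\<And>A. A \<in> sets M' \<Longrightarrow> \<alpha>' A = set_lebesgue_integral L' A a'"
    using sigma_additive_density[OF sa(2)] by blast
  obtain K b where b: "finite_measure K" "sets K = sets N" "integrable K b"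
    "\<And>A. A \<in> sets N \<Longrightarrow> \<beta> A = set_lebesgue_integral K A b"
    using sigma_additive_density[OF sa(3)] by blast
  obtain K' b' where b': "finite_measure K'" "sets K' = sets N'" "integrable K' b'"
    "\<And>A. A \<in> sets N' \<Longrightarrow> \<beta>' A = set_lebesgue_integral K' A b'"
    using sigma_additive_density[OF sa(4)] by blast
  have "zonoid L a \<subseteq> zonoid L' a'" "zonoid K b \<subseteq> zonoid K' b'"
    using assms(5,6)
    by (simp_all add: lorenz_hull_eq_zonoid[OF a(2,4)] lorenz_hull_eq_zonoid[OF a'(2,4)]
        lorenz_hull_eq_zonoid[OF b(2,4)] lorenz_hull_eq_zonoid[OF b'(2,4)])
  then have "zonoid (L \<Otimes>\<^sub>M K) (\<lambda>z. a (fst z) * b (snd z))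
      \<subseteq> zonoid (L' \<Otimes>\<^sub>M K') (\<lambda>z. a' (fst z) * b' (snd z))"
    by (intro zonoid_product_mono sf[OF a(1)] sf[OF a'(1)] sf[OF b(1)] sf[OF b'(1)] a(3) a'(3) b(3) b'(3))
  then show ?thesis
    by (simp only: lorenz_hull_vector_prod_measure[OF sf[OF a(1)] sf[OF b(1)] a(2) b(2) a(3) b(3) a(4) b(4)]
        lorenz_hull_vector_prod_measure[OF sf[OF a'(1)] sf[OF b'(1)] a'(2) b'(2) a'(3) b'(3) a'(4) b'(4)])
qed

end
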